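(* Let $\mathbb{F}$ be a field of characteristic $p>2$, let $(A,L,[\cdot,\cdot],(\cdot)^{[p]},\rho)$ be a restricted Lie-Rinehart algebra over $\mathbb{F}$, and let $(m,\omega)=([\cdot,\cdot],(\cdot)^{[p]})$ be the associated restricted multiderivation. Let $(m_t,\omega_t)$ and $(m'_t,\omega'_t)$ be two equivalent formal deformations of $(m,\omega)$. Then their infinitesimal elements $(m_1,\omega_1)$ and $(m_1',\omega_1')$ are in the same cohomology class of the restricted cohomology $H^2_*(L,L)$, i.e. they differ by an element of $B^2_*(L,L)$.
   Context: All algebras are finite-dimensional. **Restricted Lie algebra.** A Lie algebra $L$ over $\mathbb F$ with a map $(\cdot)^{[p]}:L\to L$ such that $(\lambda x)^{[p]}=\lambda^px^{[p]}$, $[x,y^{[p]}]=[[\cdots[x,y],y],\cdots,y]$ ($p$ copies of $y$), and $(x+y)^{[p]}=x^{[p]}+y^{[p]}+\sum_{i=1}^{p-1}s_i(x,y)$, where $i\,s_i(x,y)$ is the coefficient of $Z^{i-1}$ in $\mathrm{ad}_{Zx+y}^{p-1}(x)$. **Restricted Lie-Rinehart algebra.** $A$ is a commutative associative $\mathbb F$-algebra, $L$ is a restricted Lie algebra and an $A$-module, and $\rho:L\to \mathrm{Der}(A)$ (the anchor) is a morphism of Lie algebras and of $A$-modules with $[x,ay]=\rho(x)(a)y+a[x,y]$, $\rho(x^{[p]})=\rho(x)^p$ and $(ax)^{[p]}=a^px^{[p]}+\rho(ax)^{p-1}(a)x$. **Restricted multiderivation (of order 1).** A pair $(m,\omega)$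 with $m:L\times L\to L$ skew-symmetric bilinear, $\omega:L\to L$ with $\omega(\lambda x)=\lambda^p\omega(x)$ and $\omega(x+y)=\omega(x)+\omega(y)+\sum_{i=1}^{p-1}\theta_i(x,y)$, where $i\theta_i(x,y)$ is the coefficient of $Z^{i-1}$ in $(\widetilde{\mathrm{ad}}_m(Zx+y))^{p-1}(x)$, $\widetilde{\mathrm{ad}}_m(x)(y)=m(x,y)$, such that there is a map $\sigma:L\to\mathrm{Der}(A)$ (symbol map) with $\sigma(ax)=a\sigma(x)$, $m(x,ay)=am(x,y)+\sigma(x)(a)y$, $\sigma(\omega(x))=\sigma(x)^p$, $\omega(ax)=a^p\omega(x)+\sigma(ax)^{p-1}(a)x$. The multiderivation associated to a restricted Lie-Rinehart algebra has symbol map $\rho$. **Formal deformation of $(m,\omega)$.** Maps $m_t=\sum_{i\ge0}t^im_i$, $\omega_t=\sum_{j\ge0}t^j\omega_j$ with $m_0=m$, $\omega_0=\omega$ and each $(m_i,\omega_i)$ a restricted multiderivation with symbol map $\sigma_i$, such that for all $x,y,z\in L$, $a\in A$: (1) $m_t(x,m_t(y,z))+m_t(y,m_t(z,x))+m_t(z,m_t(x,y))=0$; (2) $m_t(x,\omega_t(y))=m_t(m_t(\cdots m_t(x,y),y),\cdots,y)$ ($p$ copies of $y$ on the right); (3) $\sum_{i=0}^k\sigma_i(\omega_{k-i}(x))(a)=\sum_{i_1+\cdots+i_p=k}\sigma_{i_1}(x)\circ\cdots\circ\sigma_{i_p}(x)(a)$ for all $k\ge0$; (4) $\sigma_k(x)^{p-1}=\sum_{i_1+\cdots+i_{p-1}=k}\sigma_{i_1}(x)\circ\cdots\circ\sigma_{i_{p-1}}(x)$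 for all $k\ge 0$. Here $m_t$ is extended to $L[[t]]$ by $\mathbb F[[t]]$-linearity, and $\omega_t$ is extended to $L[[t]]$ by $p$-homogeneity and by $\omega_t(x+y)=\omega_t(x)+\omega_t(y)+\sum_{k=1}^{p-1}s_k^t(x,y)$, where $k\,s^t_k(x,y)$ is the coefficient of $Z^{k-1}$ in $(\widetilde{\mathrm{ad}}_{m_t}(Zx+y))^{p-1}(x)$; this formula also holds for $x,y\in L$. **Equivalence.** $(m_t,\omega_t)$ and $(m_t',\omega_t')$ are equivalent (by $\phi$) if there is a formal automorphism $\phi=\sum_{i\ge0}t^i\phi_i$ of $L[[t]]$ ($\phi_i:L\to L$ $\mathbb F$-linear, $\phi_0=\mathrm{id}$, extended $\mathbb F[[t]]$-linearly) such that for all $x,y\in L$: $m_t(\phi(x),\phi(y))=\phi(m'_t(x,y))$ and $\phi(\omega_t(x))=\omega'_t(\phi(x))$. **Restricted cohomology (adjoint coefficients, $x\cdot u=[x,u]$).** $C^1_*(L,L)=\mathrm{Hom}_{\mathbb F}(L,L)$. $C^2_*(L,L)$ is the set of pairs $(\varphi,w)$ with $\varphi:L\times L\to L$ skew-symmetric bilinear and $w:L\to L$ with $w(\lambda x)=\lambda^pw(x)$ and $$w(x+y)=w(x)+w(y)+\sum_{x_i\in\{x,y\},\,x_1=x,\,x_2=y}\frac{1}{\sharp\{x\}}\sum_{k=0}^{p-2}(-1)^kx_p\cdots x_{p-k+1}\varphi([[\cdots[x_1,x_2],x_3]\cdots,x_{p-k-1}],x_{p-k}),$$ where $\sharp\{x\}$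 is the number of $x_i$ equal to $x$. The differentials are $d^1_*\psi=(d^1_{CE}\psi,\mathrm{ind}^1(\psi))$ with $d^1_{CE}\psi(x,y)=\psi([x,y])-[x,\psi(y)]+[y,\psi(x)]$ and $\mathrm{ind}^1(\psi)(x)=\psi(x^{[p]})-\mathrm{ad}_x^{p-1}(\psi(x))$; and $d^2_*(\varphi,w)=(d^2_{CE}\varphi,\mathrm{ind}^2(\varphi,w))$ with $d^2_{CE}\varphi(x,y,z)=\varphi([x,y],z)-\varphi([x,z],y)+\varphi([y,z],x)-[x,\varphi(y,z)]+[y,\varphi(x,z)]-[z,\varphi(x,y)]$ and $\mathrm{ind}^2(\varphi,w)(x,y)=\varphi(x,y^{[p]})-\sum_{i+j=p-1}(-1)^iy^i\varphi([\cdots[x,y],\cdots,y],y)+[x,w(y)]$ (with $j$ copies of $y$ in the inner bracket and $y^i$ acting by $\mathrm{ad}_y^i$). $Z^2_*(L,L)=\ker d^2_*$, $B^2_*(L,L)=\mathrm{Im}\,d^1_*$, $H^2_*(L,L)=Z^2_*(L,L)/B^2_*(L,L)$.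
   Formalization: In the definition of equivalence, the condition φ(ω_t(x)) = ω'_t(φ(x)) is replaced by ω_t(φ(x)) = φ(ω'_t(x)), the same orientation as the bracket condition; with the mixed orientation the claim fails, e.g. on a sum of two Heisenberg algebras. *)

theory Defs
  imports "HOL-Computational_Algebra.Computational_Algebra"
begin

section \<open>Algebras and restricted Lie algebras\<close>

text \<open>
  The vector spaces are types with an explicit scalar multiplication
  (\<open>sA\<close> on \<open>A\<close>, \<open>sL\<close> on \<open>L\<close>), \<open>act\<close> is the action of \<open>A\<close> on \<open>L\<close>, and \<open>p\<close> is meant to be the
  characteristic of the ground field.
\<close>

definition finite_dim :: "('k::field \<Rightarrow> 'v::ab_group_add \<Rightarrow> 'v) \<Rightarrow> bool" where
  "finite_dim s \<longleftrightarrow> vector_space s \<and> (\<exists>B. finite B \<and> module.span s B = UNIV)"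

definition bilinear_map :: "('k::field \<Rightarrow> 'v::ab_group_add \<Rightarrow> 'v) \<Rightarrow> ('v \<Rightarrow> 'v \<Rightarrow> 'v) \<Rightarrow> bool" where
  "bilinear_map s m \<longleftrightarrow>
     (\<forall>x. Vector_Spaces.linear s s (m x)) \<and> (\<forall>y. Vector_Spaces.linear s s (\<lambda>x. m x y))"

text \<open>The extension of \<open>m\<close> to polynomials in \<open>Z\<close> with coefficients in \<open>V\<close>, bilinear over
  polynomials in \<open>Z\<close>.\<close>
definition poly_ext :: "('v::ab_group_add \<Rightarrow> 'v \<Rightarrow> 'v) \<Rightarrow> 'v poly \<Rightarrow> 'v poly \<Rightarrow> 'v poly" where
  "poly_ext m P Q = (\<Sum>i\<le>degree P. \<Sum>j\<le>degree Q. monom (m (coeff P i) (coeff Q j)) (i + j))"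

text \<open>The element \<open>s\<^sub>i(x, y)\<close> with \<open>i s\<^sub>i(x, y)\<close> the coefficient of \<open>Z^(i-1)\<close> in
  \<open>ad(Zx + y)^(p-1) (x)\<close>, where \<open>ad(u)(v) = m u v\<close>. Here \<open>[:y, x:]\<close> is \<open>Zx + y\<close>, and \<open>i\<close> is invertible
  in the ground field for \<open>0 < i < p\<close>.\<close>
definition jacobson_term ::
    "nat \<Rightarrow> ('k::field \<Rightarrow> 'v::ab_group_add \<Rightarrow> 'v) \<Rightarrow> ('v \<Rightarrow> 'v \<Rightarrow> 'v) \<Rightarrow> nat \<Rightarrow> 'v \<Rightarrow> 'v \<Rightarrow> 'v" where
  "jacobson_term p s m i x y =
     s (inverse (of_nat i)) (coeff ((poly_ext m [:y, x:] ^^ (p - 1)) [:x:]) (i - 1))"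

definition restricted_lie_algebra ::
    "nat \<Rightarrow> ('k::field \<Rightarrow> 'l::ab_group_add \<Rightarrow> 'l) \<Rightarrow> ('l \<Rightarrow> 'l \<Rightarrow> 'l) \<Rightarrow> ('l \<Rightarrow> 'l) \<Rightarrow> bool" where
  "restricted_lie_algebra p s br pm \<longleftrightarrow>
     bilinear_map s br \<and>
     (\<forall>x. br x x = 0) \<and>
     (\<forall>x y z. br x (br y z) + br y (br z x) + br z (br x y) = 0) \<and>
     (\<forall>c x. pm (s c x) = s (c ^ p) (pm x)) \<and>
     (\<forall>x y. br x (pm y) = ((\<lambda>u. br u y) ^^ p) x) \<and>
     (\<forall>x y. pm (x + y) = pm x + pm y + (\<Sum>i=1..p - 1. jacobson_term p s br i x y))"

definition comm_algebra :: "('k::field \<Rightarrow> 'a::comm_ring \<Rightarrow> 'a) \<Rightarrow> bool" where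
  "comm_algebra sA \<longleftrightarrow> vector_space sA \<and> (\<forall>c a b. sA c a * b = sA c (a * b))"

text \<open>A unit of \<open>A\<close> is not required, but if there is one it acts as the identity.\<close>
definition algebra_module ::
    "('k::field \<Rightarrow> 'a::comm_ring \<Rightarrow> 'a) \<Rightarrow> ('k \<Rightarrow> 'l::ab_group_add \<Rightarrow> 'l) \<Rightarrow> ('a \<Rightarrow> 'l \<Rightarrow> 'l) \<Rightarrow> bool" where
  "algebra_module sA sL act \<longleftrightarrow>
     (\<forall>a. Vector_Spaces.linear sL sL (act a)) \<and>
     (\<forall>x. Vector_Spaces.linear sA sL (\<lambda>a. act a x)) \<and>
     (\<forall>a b x. act (a * b) x = act a (act b x)) \<and>
     (\<forall>e. (\<forall>a. e * a = a) \<longrightarrow> (\<forall>x. act e x = x))"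

definition Der :: "('k::field \<Rightarrow> 'a::comm_ring \<Rightarrow> 'a) \<Rightarrow> ('a \<Rightarrow> 'a) set" where
  "Der sA = {D. Vector_Spaces.linear sA sA D \<and> (\<forall>a b. D (a * b) = D a * b + a * D b)}"

text \<open>The power \<open>a^n\<close> for \<open>n \<ge> 1\<close>, without using a unit.\<close>
definition mult_power :: "'a::comm_ring \<Rightarrow> nat \<Rightarrow> 'a" where
  "mult_power a n = ((\<lambda>b. a * b) ^^ (n - 1)) a"

definition restricted_lie_rinehart ::
    "nat \<Rightarrow> ('k::field \<Rightarrow> 'a::comm_ring \<Rightarrow> 'a) \<Rightarrow> ('k \<Rightarrow> 'l::ab_group_add \<Rightarrow> 'l) \<Rightarrow> ('a \<Rightarrow> 'l \<Rightarrow> 'l) \<Rightarrow>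
     ('l \<Rightarrow> 'l \<Rightarrow> 'l) \<Rightarrow> ('l \<Rightarrow> 'l) \<Rightarrow> ('l \<Rightarrow> 'a \<Rightarrow> 'a) \<Rightarrow> bool" where
  "restricted_lie_rinehart p sA sL act br pm \<rho> \<longleftrightarrow>
     finite_dim sA \<and> finite_dim sL \<and>
     comm_algebra sA \<and> algebra_module sA sL act \<and> restricted_lie_algebra p sL br pm \<and>
     (\<forall>x. \<rho> x \<in> Der sA) \<and>
     (\<forall>a. Vector_Spaces.linear sL sA (\<lambda>x. \<rho> x a)) \<and>
     (\<forall>x y a. \<rho> (br x y) a = \<rho> x (\<rho> y a) - \<rho> y (\<rho> x a)) \<and>
     (\<forall>a x b. \<rho> (act a x) b = a * \<rho> x b) \<and>
     (\<forall>x y a. br x (act a y) = act (\<rho> x a) y + act a (br x y)) \<and>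
     (\<forall>x. \<rho> (pm x) = \<rho> x ^^ p) \<and>
     (\<forall>a x. pm (act a x) = act (mult_power a p) (pm x) + act ((\<rho> (act a x) ^^ (p - 1)) a) x)"

section \<open>Restricted multiderivations\<close>

definition restricted_multiderivation ::
    "nat \<Rightarrow> ('k::field \<Rightarrow> 'a::comm_ring \<Rightarrow> 'a) \<Rightarrow> ('k \<Rightarrow> 'l::ab_group_add \<Rightarrow> 'l) \<Rightarrow> ('a \<Rightarrow> 'l \<Rightarrow> 'l) \<Rightarrow>
     ('l \<Rightarrow> 'l \<Rightarrow> 'l) \<Rightarrow> ('l \<Rightarrow> 'l) \<Rightarrow> ('l \<Rightarrow> 'a \<Rightarrow> 'a) \<Rightarrow> bool" where
  "restricted_multiderivation p sA sL act m \<omega> \<sigma> \<longleftrightarrow>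
     bilinear_map sL m \<and> (\<forall>x y. m x y = - m y x) \<and>
     (\<forall>c x. \<omega> (sL c x) = sL (c ^ p) (\<omega> x)) \<and>
     (\<forall>x y. \<omega> (x + y) = \<omega> x + \<omega> y + (\<Sum>i=1..p - 1. jacobson_term p sL m i x y)) \<and>
     (\<forall>x. \<sigma> x \<in> Der sA) \<and>
     (\<forall>a x b. \<sigma> (act a x) b = a * \<sigma> x b) \<and>
     (\<forall>x a y. m x (act a y) = act a (m x y) + act (\<sigma> x a) y) \<and>
     (\<forall>x. \<sigma> (\<omega> x) = \<sigma> x ^^ p) \<and>
     (\<forall>a x. \<omega> (act a x) = act (mult_power a p) (\<omega> x) + act ((\<sigma> (act a x) ^^ (p - 1)) a) x)"

section \<open>Formal deformations\<close>

text \<open>\<open>F[[t]]\<close> and \<open>L[[t]]\<close> are the types \<open>'k fps\<close> and \<open>'l fps\<close>; \<open>L\<close> sits in \<open>L[[t]]\<close> via \<^const>\<open>fps_const\<close>.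
  First the \<open>F[[t]]\<close>-module structure of \<open>L[[t]]\<close> and the induced \<open>F\<close>-vector space structure.\<close>

definition fps_smult ::
    "('k::field \<Rightarrow> 'l::ab_group_add \<Rightarrow> 'l) \<Rightarrow> 'k fps \<Rightarrow> 'l fps \<Rightarrow> 'l fps" where
  "fps_smult s f u = Abs_fps (\<lambda>n. \<Sum>i\<le>n. s (fps_nth f i) (fps_nth u (n - i)))"

definition fps_scale :: "('k::field \<Rightarrow> 'l::ab_group_add \<Rightarrow> 'l) \<Rightarrow> 'k \<Rightarrow> 'l fps \<Rightarrow> 'l fps" where
  "fps_scale s c u = fps_smult s (fps_const c) u"

text \<open>For \<open>f = (f\<^sub>0, f\<^sub>1, \<dots>)\<close> and \<open>x\<close> in \<open>L\<close>, the series \<open>f\<^sub>t(x) = \<Sum>t^i f\<^sub>i(x)\<close>.\<close>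
definition series :: "(nat \<Rightarrow> 'l \<Rightarrow> 'l) \<Rightarrow> 'l \<Rightarrow> 'l fps" where
  "series f x = Abs_fps (\<lambda>i. f i x)"

text \<open>The \<open>F[[t]]\<close>-linear extensions to \<open>L[[t]]\<close> of \<open>\<phi> = \<Sum>t^i \<phi>\<^sub>i\<close> and of \<open>m\<^sub>t = \<Sum>t^i m\<^sub>i\<close>.\<close>
definition lin_ext :: "(nat \<Rightarrow> 'l \<Rightarrow> 'l) \<Rightarrow> 'l::ab_group_add fps \<Rightarrow> 'l fps" where
  "lin_ext \<phi> u = Abs_fps (\<lambda>n. \<Sum>i\<le>n. \<phi> i (fps_nth u (n - i)))"

definition bilin_ext :: "(nat \<Rightarrow> 'l \<Rightarrow> 'l \<Rightarrow> 'l) \<Rightarrow> 'l::ab_group_add fps \<Rightarrow> 'l fps \<Rightarrow> 'l fps" where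
  "bilin_ext m u v =
     Abs_fps (\<lambda>n. \<Sum>i\<le>n. \<Sum>j\<le>n - i. m i (fps_nth u j) (fps_nth v (n - i - j)))"

text \<open>\<open>W\<close> is the extension of \<open>\<omega>\<^sub>t\<close> to \<open>L[[t]]\<close> (by \<open>p\<close>-homogeneity over \<open>F[[t]]\<close> and the
  Jacobson formula for \<open>m\<^sub>t\<close>). If \<open>L\<close> is finite-dimensional there is at most one such \<open>W\<close>, as every
  element of \<open>L[[t]]\<close> is a finite sum of products \<open>f x\<close> with \<open>f\<close> in \<open>F[[t]]\<close> and \<open>x\<close> in \<open>L\<close>.\<close>
definition is_omega_ext ::
    "nat \<Rightarrow> ('k::field \<Rightarrow> 'l::ab_group_add \<Rightarrow> 'l) \<Rightarrow> (nat \<Rightarrow> 'l \<Rightarrow> 'l \<Rightarrow> 'l) \<Rightarrow> (nat \<Rightarrow> 'l \<Rightarrow> 'l) \<Rightarrow>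
     ('l fps \<Rightarrow> 'l fps) \<Rightarrow> bool" where
  "is_omega_ext p s m \<omega> W \<longleftrightarrow>
     (\<forall>x. W (fps_const x) = series \<omega> x) \<and>
     (\<forall>f u. W (fps_smult s f u) = fps_smult s (f ^ p) (W u)) \<and>
     (\<forall>u v. W (u + v) = W u + W v +
        (\<Sum>k=1..p - 1. jacobson_term p (fps_scale s) (bilin_ext m) k u v))"

text \<open>The multi-indices \<open>(i\<^sub>1, \<dots>, i\<^sub>n)\<close> with sum \<open>k\<close> and the sum of the composites
  \<open>\<sigma>\<^bsub>i\<^sub>1\<^esub>(x) \<circ> \<dots> \<circ> \<sigma>\<^bsub>i\<^sub>n\<^esub>(x)\<close> over them, evaluated at \<open>a\<close>.\<close>
definition symbol_composites ::
    "(nat \<Rightarrow> 'l \<Rightarrow> 'a::comm_ring \<Rightarrow> 'a) \<Rightarrow> nat \<Rightarrow> nat \<Rightarrow> 'l \<Rightarrow> 'a \<Rightarrow> 'a" where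
  "symbol_composites \<sigma> n k x a =
     (\<Sum>is\<in>{is. length is = n \<and> sum_list is = k}. foldr (\<lambda>i b. \<sigma> i x b) is a)"

definition formal_deformation ::
    "nat \<Rightarrow> ('k::field \<Rightarrow> 'a::comm_ring \<Rightarrow> 'a) \<Rightarrow> ('k \<Rightarrow> 'l::ab_group_add \<Rightarrow> 'l) \<Rightarrow> ('a \<Rightarrow> 'l \<Rightarrow> 'l) \<Rightarrow>
     ('l \<Rightarrow> 'l \<Rightarrow> 'l) \<Rightarrow> ('l \<Rightarrow> 'l) \<Rightarrow> ('l \<Rightarrow> 'a \<Rightarrow> 'a) \<Rightarrow>
     (nat \<Rightarrow> 'l \<Rightarrow> 'l \<Rightarrow> 'l) \<Rightarrow> (nat \<Rightarrow> 'l \<Rightarrow> 'l) \<Rightarrow> bool" where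
  "formal_deformation p sA sL act br pm \<rho> m \<omega> \<longleftrightarrow>
     m 0 = br \<and> \<omega> 0 = pm \<and>
     (\<exists>\<sigma>. \<sigma> 0 = \<rho> \<and>
       (\<forall>i. restricted_multiderivation p sA sL act (m i) (\<omega> i) (\<sigma> i)) \<and>
       (\<forall>x y z.
          bilin_ext m (fps_const x) (bilin_ext m (fps_const y) (fps_const z)) +
          bilin_ext m (fps_const y) (bilin_ext m (fps_const z) (fps_const x)) +
          bilin_ext m (fps_const z) (bilin_ext m (fps_const x) (fps_const y)) = 0) \<and>
       (\<forall>x y. bilin_ext m (fps_const x) (series \<omega> y) =
          ((\<lambda>u. bilin_ext m u (fps_const y)) ^^ p) (fps_const x)) \<and>
       (\<forall>x y. series \<omega> (x + y) = series \<omega> x + series \<omega> y +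
          (\<Sum>k=1..p - 1. jacobson_term p (fps_scale sL) (bilin_ext m) k (fps_const x) (fps_const y))) \<and>
       (\<forall>k x a. (\<Sum>i\<le>k. \<sigma> i (\<omega> (k - i) x) a) = symbol_composites \<sigma> p k x a) \<and>
       (\<forall>k x a. (\<sigma> k x ^^ (p - 1)) a = symbol_composites \<sigma> (p - 1) k x a))"

text \<open>
  \<open>\<phi>\<close> is an isomorphism from \<open>(L[[t]], m'\<^sub>t, \<omega>'\<^sub>t)\<close> to \<open>(L[[t]], m\<^sub>t, \<omega>\<^sub>t)\<close>; the condition
  \<open>\<phi>\<^sub>0 = id\<close> makes \<open>\<phi>\<close> invertible.
  Both conditions are oriented in the same direction, as they must be for \<open>\<phi>\<close> to be a morphism of
  restricted structures. One also finds the mixed form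
  \<open>m\<^sub>t(\<phi> x, \<phi> y) = \<phi>(m'\<^sub>t(x, y))\<close>, \<open>\<phi>(\<omega>\<^sub>t x) = \<omega>'\<^sub>t(\<phi> x)\<close>; it is not an isomorphism condition, and
  infinitesimals of deformations related by it need not be cohomologous. Exchanging the two
  deformations amounts to replacing \<open>\<phi>\<close> by its inverse, so correcting the mixed form in
  its first or in its second condition gives the same relation.
\<close>
definition equivalent_deformations ::
    "nat \<Rightarrow> ('k::field \<Rightarrow> 'l::ab_group_add \<Rightarrow> 'l) \<Rightarrow> (nat \<Rightarrow> 'l \<Rightarrow> 'l \<Rightarrow> 'l) \<Rightarrow> (nat \<Rightarrow> 'l \<Rightarrow> 'l) \<Rightarrow>
     (nat \<Rightarrow> 'l \<Rightarrow> 'l \<Rightarrow> 'l) \<Rightarrow> (nat \<Rightarrow> 'l \<Rightarrow> 'l) \<Rightarrow> bool" where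
  "equivalent_deformations p s m \<omega> m' \<omega>' \<longleftrightarrow>
     (\<exists>\<phi> W. \<phi> 0 = id \<and> (\<forall>i. Vector_Spaces.linear s s (\<phi> i)) \<and>
       is_omega_ext p s m \<omega> W \<and>
       (\<forall>x y. bilin_ext m (series \<phi> x) (series \<phi> y) =
          lin_ext \<phi> (bilin_ext m' (fps_const x) (fps_const y))) \<and>
       (\<forall>x. W (series \<phi> x) = lin_ext \<phi> (series \<omega>' x)))"

section \<open>Restricted cohomology with adjoint coefficients\<close>

text \<open>The left-normed bracket \<open>[[\<dots>[x\<^sub>1, x\<^sub>2], \<dots>], x\<^sub>n]\<close>, for \<open>n \<ge> 1\<close>.\<close>
definition left_bracket :: "('l \<Rightarrow> 'l \<Rightarrow> 'l) \<Rightarrow> (nat \<Rightarrow> 'l) \<Rightarrow> nat \<Rightarrow> 'l" where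
  "left_bracket br X n = foldl br (X 1) (map X [2..<Suc n])"

text \<open>The choices of \<open>x\<^sub>1, \<dots>, x\<^sub>p\<close> in \<open>{x, y}\<close> with \<open>x\<^sub>1 = x\<close>, \<open>x\<^sub>2 = y\<close> are formal words, encoded by
  the set \<open>I\<close> of positions carrying the letter \<open>x\<close> (so they stay distinct if \<open>x = y\<close>).\<close>
definition C2_correction ::
    "nat \<Rightarrow> ('k::field \<Rightarrow> 'l::ab_group_add \<Rightarrow> 'l) \<Rightarrow> ('l \<Rightarrow> 'l \<Rightarrow> 'l) \<Rightarrow> ('l \<Rightarrow> 'l \<Rightarrow> 'l) \<Rightarrow> 'l \<Rightarrow> 'l \<Rightarrow> 'l" where
  "C2_correction p s br \<phi> x y =
     (\<Sum>I\<in>{I. I \<subseteq> {1..p} \<and> 1 \<in> I \<and> 2 \<notin> I}.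
        let X = (\<lambda>i. if i \<in> I then x else y) in
        s (inverse (of_nat (card I)))
          (\<Sum>k=0..p - 2. s ((- 1) ^ k)
             (foldr (\<lambda>i u. br (X i) u) (rev [p - k + 1..<p + 1])
                (\<phi> (left_bracket br X (p - k - 1)) (X (p - k))))))"

definition C1 :: "('k::field \<Rightarrow> 'l::ab_group_add \<Rightarrow> 'l) \<Rightarrow> ('l \<Rightarrow> 'l) set" where
  "C1 s = {\<psi>. Vector_Spaces.linear s s \<psi>}"

definition C2 ::
    "nat \<Rightarrow> ('k::field \<Rightarrow> 'l::ab_group_add \<Rightarrow> 'l) \<Rightarrow> ('l \<Rightarrow> 'l \<Rightarrow> 'l) \<Rightarrow> (('l \<Rightarrow> 'l \<Rightarrow> 'l) \<times> ('l \<Rightarrow> 'l)) set" where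
  "C2 p s br = {(\<phi>, w).
     bilinear_map s \<phi> \<and> (\<forall>x y. \<phi> x y = - \<phi> y x) \<and>
     (\<forall>c x. w (s c x) = s (c ^ p) (w x)) \<and>
     (\<forall>x y. w (x + y) = w x + w y + C2_correction p s br \<phi> x y)}"

definition d1 ::
    "nat \<Rightarrow> ('l::ab_group_add \<Rightarrow> 'l \<Rightarrow> 'l) \<Rightarrow> ('l \<Rightarrow> 'l) \<Rightarrow> ('l \<Rightarrow> 'l) \<Rightarrow> ('l \<Rightarrow> 'l \<Rightarrow> 'l) \<times> ('l \<Rightarrow> 'l)" where
  "d1 p br pm \<psi> =
     (\<lambda>x y. \<psi> (br x y) - br x (\<psi> y) + br y (\<psi> x),
      \<lambda>x. \<psi> (pm x) - (br x ^^ (p - 1)) (\<psi> x))"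

definition d2_CE ::
    "('l::ab_group_add \<Rightarrow> 'l \<Rightarrow> 'l) \<Rightarrow> ('l \<Rightarrow> 'l \<Rightarrow> 'l) \<Rightarrow> 'l \<Rightarrow> 'l \<Rightarrow> 'l \<Rightarrow> 'l" where
  "d2_CE br \<phi> x y z =
     \<phi> (br x y) z - \<phi> (br x z) y + \<phi> (br y z) x
     - br x (\<phi> y z) + br y (\<phi> x z) - br z (\<phi> x y)"

definition ind2 ::
    "nat \<Rightarrow> ('k::field \<Rightarrow> 'l::ab_group_add \<Rightarrow> 'l) \<Rightarrow> ('l \<Rightarrow> 'l \<Rightarrow> 'l) \<Rightarrow> ('l \<Rightarrow> 'l) \<Rightarrow>
     ('l \<Rightarrow> 'l \<Rightarrow> 'l) \<Rightarrow> ('l \<Rightarrow> 'l) \<Rightarrow> 'l \<Rightarrow> 'l \<Rightarrow> 'l" where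
  "ind2 p s br pm \<phi> w x y =
     \<phi> x (pm y)
     - (\<Sum>i=0..p - 1. s ((- 1) ^ i) ((br y ^^ i) (\<phi> (((\<lambda>u. br u y) ^^ (p - 1 - i)) x) y)))
     + br x (w y)"

definition Z2 ::
    "nat \<Rightarrow> ('k::field \<Rightarrow> 'l::ab_group_add \<Rightarrow> 'l) \<Rightarrow> ('l \<Rightarrow> 'l \<Rightarrow> 'l) \<Rightarrow> ('l \<Rightarrow> 'l) \<Rightarrow>
     (('l \<Rightarrow> 'l \<Rightarrow> 'l) \<times> ('l \<Rightarrow> 'l)) set" where
  "Z2 p s br pm = {(\<phi>, w) \<in> C2 p s br.
     (\<forall>x y z. d2_CE br \<phi> x y z = 0) \<and> (\<forall>x y. ind2 p s br pm \<phi> w x y = 0)}"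

definition B2 ::
    "nat \<Rightarrow> ('k::field \<Rightarrow> 'l::ab_group_add \<Rightarrow> 'l) \<Rightarrow> ('l \<Rightarrow> 'l \<Rightarrow> 'l) \<Rightarrow> ('l \<Rightarrow> 'l) \<Rightarrow>
     (('l \<Rightarrow> 'l \<Rightarrow> 'l) \<times> ('l \<Rightarrow> 'l)) set" where
  "B2 p s br pm = d1 p br pm ` C1 s"

definition cochain_diff ::
    "('l::ab_group_add \<Rightarrow> 'l \<Rightarrow> 'l) \<times> ('l \<Rightarrow> 'l) \<Rightarrow> ('l \<Rightarrow> 'l \<Rightarrow> 'l) \<times> ('l \<Rightarrow> 'l) \<Rightarrow>
     ('l \<Rightarrow> 'l \<Rightarrow> 'l) \<times> ('l \<Rightarrow> 'l)" where
  "cochain_diff c c' = (\<lambda>x y. fst c x y - fst c' x y, \<lambda>x. snd c x - snd c' x)"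

definition H2 ::
    "nat \<Rightarrow> ('k::field \<Rightarrow> 'l::ab_group_add \<Rightarrow> 'l) \<Rightarrow> ('l \<Rightarrow> 'l \<Rightarrow> 'l) \<Rightarrow> ('l \<Rightarrow> 'l) \<Rightarrow>
     (('l \<Rightarrow> 'l \<Rightarrow> 'l) \<times> ('l \<Rightarrow> 'l)) set set" where
  "H2 p s br pm = Z2 p s br pm //
     {(c, c'). c \<in> Z2 p s br pm \<and> c' \<in> Z2 p s br pm \<and> cochain_diff c c' \<in> B2 p s br pm}"

end

theory Submission
  imports Defs
begin

text \<open>
  Everything is a comparison of coefficients of \<open>t\<close>. The Jacobson terms of \<open>m\<^sub>t\<close> add up to a sum over
  words in \<open>x\<close> and \<open>y\<close> of iterated brackets, with the inverse number of letters \<open>x\<close> as weight. The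
  coefficient of \<open>t\<close> of an iterated bracket replaces one of its brackets by \<open>m\<^sub>1\<close>; as \<open>p\<close> is odd, this
  turns the additivity rule of \<open>\<omega>\<^sub>t\<close> into the cochain condition, and the other deformation equations
  into the cocycle conditions. For the comparison, write \<open>\<phi>(x) = x + t v\<close> with \<open>v \<equiv> \<phi>\<^sub>1(x)\<close> modulo \<open>t\<close>.
  In \<open>\<omega>\<^sub>t(x + t v)\<close> the summand \<open>\<omega>\<^sub>t(t v) = t^p \<omega>\<^sub>t(v)\<close> does not matter, and of the Jacobson terms only
  the one of degree \<open>1\<close> in \<open>t v\<close> does; it is \<open>t ad(x)^(p-1)(\<phi>\<^sub>1(x))\<close>. Hence the infinitesimals differ by
  the coboundary of \<open>\<phi>\<^sub>1\<close>.
\<close>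

section \<open>Biadditive maps and their extension to polynomials\<close>

locale biadditive =
  fixes M :: "'v::ab_group_add \<Rightarrow> 'v \<Rightarrow> 'v"
  assumes add_left: "M (x + y) z = M x z + M y z"
    and add_right: "M x (y + z) = M x y + M x z"
begin

sublocale left: additive "\<lambda>x. M x y" for y
  by unfold_locales (rule add_left)

sublocale right: additive "M x" for x
  by unfold_locales (rule add_right)

text \<open>Coefficients beyond the degree vanish and \<open>M\<close> kills zero, so the degree
  bounds in \<open>poly_ext\<close> drop out and a Cauchy product remains.\<close>

lemma coeff_poly_ext: "coeff (poly_ext M P Q) n = (\<Sum>i\<le>n. M (coeff P i) (coeff Q (n - i)))"
proof -
  have inner: "(\<Sum>j\<le>degree Q. coeff (monom (M a (coeff Q j)) (i + j)) n) =
      (if i \<le> n then M a (coeff Q (n - i)) else 0)" for a i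
  proof (cases "i \<le> n")
    case True
    have "(\<Sum>j\<le>degree Q. coeff (monom (M a (coeff Q j)) (i + j)) n) =
        (\<Sum>j\<le>degree Q. if j = n - i then M a (coeff Q j) else 0)"
      using True by (intro sum.cong) auto
    then show ?thesis
      using True by (simp add: coeff_eq_0 right.zero)
  qed auto
  have "coeff (poly_ext M P Q) n =
      (\<Sum>i\<le>degree P. if i \<le> n then M (coeff P i) (coeff Q (n - i)) else 0)"
    by (simp only: poly_ext_def coeff_sum inner)
  also have "\<dots> = (\<Sum>i\<le>max n (degree P). if i \<le> n then M (coeff P i) (coeff Q (n - i)) else 0)"
    by (rule sum.mono_neutral_left) (auto simp: coeff_eq_0 left.zero)
  also have "\<dots> = (\<Sum>i\<le>n. M (coeff P i) (coeff Q (n - i)))"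
    by (rule sum.mono_neutral_cong_right) auto
  finally show ?thesis .
qed

lemma coeff_poly_ext_linear:
  "coeff (poly_ext M [:y, x:] Q) n =
     M y (coeff Q n) + (if n = 0 then 0 else M x (coeff Q (n - 1)))"
proof (cases n)
  case (Suc k)
  have "(\<Sum>i\<le>n. M (coeff [:y, x:] i) (coeff Q (n - i))) =
      (\<Sum>i\<le>1. M (coeff [:y, x:] i) (coeff Q (n - i)))"
    using Suc by (intro sum.mono_neutral_right) (auto simp: coeff_pCons left.zero split: nat.splits)
  then show ?thesis
    using Suc by (simp add: coeff_poly_ext)
qed (simp add: coeff_poly_ext)

text \<open>This is how words grow under ad(Zx + y): a new letter y keeps the degree in Z, a new
  letter x raises it.\<close>

lemma poly_ext_linear_sum_monom:
  "poly_ext M [:y, x:] (\<Sum>i\<in>S. monom (w i) (d i)) =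
     (\<Sum>i\<in>S. monom (M y (w i)) (d i) + monom (M x (w i)) (Suc (d i)))"
proof -
  interpret additive "poly_ext M [:y, x:]"
    by unfold_locales (rule poly_eqI, simp add: coeff_poly_ext_linear add_right)
  have "poly_ext M [:y, x:] (monom v k) = monom (M y v) k + monom (M x v) (Suc k)" for v k
    by (rule poly_eqI) (auto simp: coeff_poly_ext_linear right.zero)
  then show ?thesis
    by (simp add: sum)
qed

end

section \<open>Words in two letters and their left-normed brackets\<close>

lemma left_bracket_1 [simp]: "left_bracket br X (Suc 0) = X 1"
  by (simp add: left_bracket_def)

lemma left_bracket_Suc:
  "n > 0 \<Longrightarrow> left_bracket br X (Suc n) = br (left_bracket br X n) (X (Suc n))"
  by (simp add: left_bracket_def)

lemma left_bracket_cong: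
  assumes "n > 0" and "\<And>i. 1 \<le> i \<Longrightarrow> i \<le> n \<Longrightarrow> X i = Y i"
  shows "left_bracket br X n = left_bracket br Y n"
  using assms unfolding left_bracket_def
  by (intro foldl_cong) (auto intro!: map_cong)

text \<open>As in \<^const>\<open>C2_correction\<close>, a word in \<open>x\<close> and \<open>y\<close> is the set of positions of its letters \<open>x\<close>.\<close>
definition xy_word :: "'v \<Rightarrow> 'v \<Rightarrow> nat set \<Rightarrow> nat \<Rightarrow> 'v" where
  "xy_word x y I i = (if i \<in> I then x else y)"

text \<open>The first letter is fixed because powers of ad(Zx + y) are applied to x.\<close>

definition words :: "nat \<Rightarrow> nat set set" where
  "words n = {I. I \<subseteq> {1..n} \<and> 1 \<in> I}"

lemma words_1: "words (Suc 0) = {{1}}"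
  by (auto simp: words_def)

lemma words_Suc:
  assumes "n > 0"
  shows "words (Suc n) = words n \<union> insert (Suc n) ` words n"
proof -
  have "I \<in> insert (Suc n) ` words n" if "I \<in> words (Suc n)" "I \<notin> words n" for I
    using that assms by (intro rev_image_eqI[of "I - {Suc n}"])
      (auto simp: words_def le_Suc_eq)
  then show ?thesis
    by (auto simp: words_def)
qed

lemma finite_words [simp]: "finite (words n)"
  by (simp add: words_def)

lemma card_word_pos: "I \<in> words n \<Longrightarrow> 0 < card I"
  by (auto simp: words_def card_gt_0_iff dest: finite_subset)

lemma Suc_notin_word: "I \<in> words n \<Longrightarrow> Suc n \<notin> I"
  by (auto simp: words_def)

section \<open>Jacobson terms as weighted sums over words\<close>

context biadditive
begin

text \<open>Each application of ad(Zx + y) appends a letter, and Z marks the appended letters x. The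
  initial x carries no Z, hence the exponent \<open>card I - 1\<close>; ad puts the new letter on
  the left, hence the flipped \<open>M\<close>.\<close>

lemma poly_ext_power_words:
  "(poly_ext M [:y, x:] ^^ n) [:x:] =
     (\<Sum>I\<in>words (Suc n).
        monom (left_bracket (\<lambda>u v. M v u) (xy_word x y I) (Suc n)) (card I - 1))"
proof (induction n)
  case 0
  show ?case
    by (simp add: words_1 xy_word_def monom_0)
next
  case (Suc n)
  let ?w = "\<lambda>I. left_bracket (\<lambda>u v. M v u) (xy_word x y I)"
  have inj: "inj_on (insert (Suc (Suc n))) (words (Suc n))"
    by (rule inj_onI) (metis Diff_insert_absorb Suc_notin_word)
  have word: "?w I (Suc (Suc n)) = M y (?w I (Suc n))"
    and word_insert: "?w (insert (Suc (Suc n)) I) (Suc (Suc n)) = M x (?w I (Suc n))"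
    and card_insert: "card (insert (Suc (Suc n)) I) = Suc (card I)"
    if I: "I \<in> words (Suc n)" for I
  proof -
    show "?w I (Suc (Suc n)) = M y (?w I (Suc n))"
      using Suc_notin_word[OF I] by (simp add: left_bracket_Suc xy_word_def)
    have "?w (insert (Suc (Suc n)) I) (Suc n) = ?w I (Suc n)"
      by (rule left_bracket_cong) (auto simp: xy_word_def)
    then show "?w (insert (Suc (Suc n)) I) (Suc (Suc n)) = M x (?w I (Suc n))"
      by (simp add: left_bracket_Suc) (simp add: xy_word_def)
    show "card (insert (Suc (Suc n)) I) = Suc (card I)"
      using Suc_notin_word[OF I] I by (auto simp: words_def dest: finite_subset)
  qed
  have "(poly_ext M [:y, x:] ^^ Suc n) [:x:] =
      (\<Sum>I\<in>words (Suc n). monom (M y (?w I (Suc n))) (card I - 1)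
        + monom (M x (?w I (Suc n))) (Suc (card I - 1)))"
    by (simp add: Suc poly_ext_linear_sum_monom)
  \<comment> \<open>Words contain position 1, so the truncated subtraction is harmless:
    \<open>Suc (card I - 1)\<close> is \<open>card I\<close>.\<close>
  also have "\<dots> = (\<Sum>I\<in>words (Suc n). monom (?w I (Suc (Suc n))) (card I - 1))
      + (\<Sum>I\<in>words (Suc n). monom (?w (insert (Suc (Suc n)) I) (Suc (Suc n)))
          (card (insert (Suc (Suc n)) I) - 1))"
    unfolding sum.distrib
    by (intro arg_cong2[of _ _ _ _ "(+)"] sum.cong)
      (auto simp: word word_insert card_insert dest: card_word_pos)
  also have "\<dots> = (\<Sum>I\<in>words (Suc (Suc n)). monom (?w I (Suc (Suc n))) (card I - 1))"
    unfolding words_Suc[OF zero_less_Suc]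
    by (subst sum.union_disjoint) (use Suc_notin_word in \<open>auto simp: sum.reindex[OF inj]\<close>)
  finally show ?case .
qed

text \<open>The word with all letters \<open>x\<close> has length \<open>p\<close> and would need the weight \<open>1/p\<close>; like every word
  beginning with \<open>x x\<close>, it vanishes.\<close>
lemma sum_jacobson_term:
  assumes "p \<ge> 2" and "M x x = 0" and "\<And>c. additive (s c)"
  shows "(\<Sum>k=1..p - 1. jacobson_term p s M k x y) =
    (\<Sum>I\<in>{I \<in> words p. 2 \<notin> I}. s (inverse (of_nat (card I)))
       (left_bracket (\<lambda>u v. M v u) (xy_word x y I) p))"
proof -
  let ?w = "\<lambda>I. left_bracket (\<lambda>u v. M v u) (xy_word x y I) p"
  have p: "Suc (p - 1) = p"
    using assms(1) by simp
  have zero: "?w I = 0" if "I \<in> words p" "2 \<in> I" for I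
  proof -
    have "left_bracket (\<lambda>u v. M v u) (xy_word x y I) (Suc (Suc n)) = 0" for n
      using that assms(2)
      by (induction n)
        (simp_all add: left_bracket_Suc words_def xy_word_def right.zero eval_nat_numeral)
    moreover have "Suc (Suc (p - 2)) = p"
      using assms(1) by simp
    ultimately show ?thesis
      by metis
  qed
  have "jacobson_term p s M k x y =
      (\<Sum>I\<in>words p. if card I = k then s (inverse (of_nat (card I))) (?w I) else 0)"
    if "k \<in> {1..p - 1}" for k
  proof -
    have "jacobson_term p s M k x y = (\<Sum>I\<in>words p.
        s (inverse (of_nat k)) (coeff (monom (?w I) (card I - 1)) (k - 1)))"
      unfolding jacobson_term_def poly_ext_power_words p coeff_sum
      by (rule additive.sum[OF assms(3)])
    also have "\<dots> = (\<Sum>I\<in>words p. if card I = k then s (inverse (of_nat (card I))) (?w I) else 0)"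
    proof (rule sum.cong)
      fix I assume "I \<in> words p"
      \<comment> \<open>Both \<open>card I\<close> and \<open>k\<close> are positive, so truncated
        subtraction can be cancelled.\<close>
      then have "card I - 1 = k - 1 \<longleftrightarrow> card I = k"
        using that card_word_pos[of I p] by auto
      then show "s (inverse (of_nat k)) (coeff (monom (?w I) (card I - 1)) (k - 1)) =
          (if card I = k then s (inverse (of_nat (card I))) (?w I) else 0)"
        by (auto simp: additive.zero[OF assms(3)])
    qed simp
    finally show ?thesis .
  qed
  then have "(\<Sum>k=1..p - 1. jacobson_term p s M k x y) =
      (\<Sum>k=1..p - 1. \<Sum>I\<in>words p. if card I = k then s (inverse (of_nat (card I))) (?w I) else 0)"
    by (rule sum.cong[OF refl])
  also have "\<dots> = (\<Sum>I\<in>words p. \<Sum>k=1..p - 1.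
      if k = card I then s (inverse (of_nat (card I))) (?w I) else 0)"
    by (subst sum.swap) (intro sum.cong refl if_cong, auto)
  also have "\<dots> = (\<Sum>I\<in>words p. if card I \<in> {1..p - 1}
      then s (inverse (of_nat (card I))) (?w I) else 0)"
    by simp
  also have "\<dots> = (\<Sum>I\<in>{I \<in> words p. 2 \<notin> I}. s (inverse (of_nat (card I))) (?w I))"
  proof (rule sum.mono_neutral_cong_right)
    show "(if card I \<in> {1..p - 1} then s (inverse (of_nat (card I))) (?w I) else 0) =
        s (inverse (of_nat (card I))) (?w I)" if I: "I \<in> {I \<in> words p. 2 \<notin> I}" for I
    proof -
      \<comment> \<open>Position 2 is missing, so fewer than \<open>p\<close> letters are x and
        their number is among the values of \<open>k\<close> summed over.\<close>
      have "I \<subset> {1..p}"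
        using I assms(1) by (auto simp: words_def)
      then have "card I < p"
        using psubset_card_mono[of "{1..p}" I] by simp
      then show ?thesis
        using card_word_pos[of I p] I by auto
    qed
  qed (auto simp: zero additive.zero[OF assms(3)])
  finally show ?thesis .
qed

end

text \<open>Each of the \<open>n\<close> brackets contributes one sign. For words of odd length
  \<open>p\<close> the signs cancel.\<close>

lemma left_bracket_flip:
  assumes "biadditive M" and "\<And>u v. M u v = - M v u"
  shows "left_bracket (\<lambda>u v. M v u) X (Suc n) =
    (if even n then left_bracket M X (Suc n) else - left_bracket M X (Suc n))"
proof (induction n)
  case (Suc n)
  interpret biadditive M
    by fact
  show ?case
    using assms(2)[of "X (Suc (Suc n))"] by (simp add: left_bracket_Suc Suc right.minus left.minus)
qed simp

section \<open>Formal power series to first order\<close>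

text \<open>With 2 invertible, skewness makes each \<open>m i\<close> alternating; this is what
  kills the words beginning with x x.\<close>

locale skew_family = vector_space s
  for s :: "'k::field \<Rightarrow> 'l::ab_group_add \<Rightarrow> 'l" +
  fixes m :: "nat \<Rightarrow> 'l \<Rightarrow> 'l \<Rightarrow> 'l"
  assumes bilinear: "bilinear_map s (m i)"
    and skew: "m i x y = - m i y x"
    and char_not_2: "(2::'k) \<noteq> 0"
begin

lemma linear_left: "Vector_Spaces.linear s s (\<lambda>x. m i x y)"
  and linear_right: "Vector_Spaces.linear s s (m i x)"
  using bilinear[of i] by (auto simp: bilinear_map_def)

lemma biadditive_m: "biadditive (m i)"
  using linear_left linear_right
  by (auto simp: biadditive_def Vector_Spaces.linear_iff)

sublocale m: biadditive "m i" for i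
  by (rule biadditive_m)

lemma m_scale_right: "m i x (s c y) = s c (m i x y)"
  using linear_right by (auto simp: Vector_Spaces.linear_iff)

lemma m_same [simp]: "m i x x = 0"
proof -
  have "s 2 (m i x x) = m i x x + m i x x"
    by (metis one_add_one scale_left_distrib scale_one)
  also have "\<dots> = 0"
    using skew[of i x x] by (metis add.right_inverse)
  finally show ?thesis
    using char_not_2 by simp
qed

abbreviation "mt \<equiv> bilin_ext m"

lemma biadditive_mt: "biadditive mt"
  by unfold_locales
    (simp_all add: fps_eq_iff bilin_ext_def m.add_left m.add_right sum.distrib)

sublocale mt: biadditive mt
  by (rule biadditive_mt)

lemma mt_skew: "mt u v = - mt v u"
proof (rule fps_ext)
  fix n
  have "(\<Sum>j\<le>n - i. m i (fps_nth u j) (fps_nth v (n - i - j))) =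
      - (\<Sum>j\<le>n - i. m i (fps_nth v j) (fps_nth u (n - i - j)))" for i
    unfolding sum_negf[symmetric]
    by (rule sum.reindex_bij_witness[of _ "\<lambda>j. n - i - j" "\<lambda>j. n - i - j"])
      (auto simp: skew[of i "fps_nth u _"] simp del: diff_diff_left)
  then show "fps_nth (mt u v) n = fps_nth (- mt v u) n"
    by (simp add: bilin_ext_def sum_negf)
qed

lemma mt_nth_0 [simp]: "fps_nth (mt u v) 0 = m 0 (fps_nth u 0) (fps_nth v 0)"
  by (simp add: bilin_ext_def)

lemma mt_nth_1 [simp]:
  "fps_nth (mt u v) (Suc 0) = m 0 (fps_nth u 0) (fps_nth v (Suc 0))
     + m 0 (fps_nth u (Suc 0)) (fps_nth v 0) + m (Suc 0) (fps_nth u 0) (fps_nth v 0)"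
  by (simp add: bilin_ext_def)

lemma mt_const_same [simp]: "mt (fps_const x) (fps_const x) = 0"
proof -
  have "m i (fps_nth (fps_const x) j) (fps_nth (fps_const x) k) = 0" for i j k
    by (simp add: m.left.zero m.right.zero)
  then show ?thesis
    by (simp add: fps_eq_iff bilin_ext_def del: fps_nth_fps_const)
qed

lemma fps_scale_nth [simp]: "fps_nth (fps_scale s c u) n = s c (fps_nth u n)"
proof -
  have "(\<Sum>i\<le>n. s (fps_nth (fps_const c) i) (fps_nth u (n - i))) =
      (\<Sum>i\<le>n. if i = 0 then s c (fps_nth u n) else 0)"
    by (intro sum.cong) auto
  then show ?thesis
    by (simp add: fps_scale_def fps_smult_def)
qed

lemma additive_fps_scale: "additive (fps_scale s c)"
  by unfold_locales (simp add: fps_eq_iff scale_right_distrib)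

section \<open>First-order coefficients of iterated brackets\<close>

lemma left_bracket_mt_nth_0:
  "fps_nth (left_bracket mt (\<lambda>i. fps_const (X i)) (Suc n)) 0 = left_bracket (m 0) X (Suc n)"
  by (induction n) (simp_all add: left_bracket_Suc)

text \<open>By the product rule exactly one bracket becomes \<open>m 1\<close>. The index
  \<open>k\<close> counts the brackets outside it; turning each into an action from the left costs a
  sign.\<close>

lemma left_bracket_mt_nth_1:
  "fps_nth (left_bracket mt (\<lambda>i. fps_const (X i)) (Suc n)) (Suc 0) =
     (\<Sum>k<n. s ((- 1) ^ k) (foldr (\<lambda>i. m 0 (X i)) (rev [Suc n - k + 1..<Suc n + 1])
        (m 1 (left_bracket (m 0) X (n - k)) (X (Suc n - k)))))"
proof (induction n)
  case (Suc n)
  let ?T = "\<lambda>n k. foldr (\<lambda>i. m 0 (X i)) (rev [Suc n - k + 1..<Suc n + 1])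
        (m 1 (left_bracket (m 0) X (n - k)) (X (Suc n - k)))"
  \<comment> \<open>A new outermost bracket acts on the old summands and shifts \<open>k\<close> by
    one; the summand \<open>k = 0\<close> is the case where it is itself \<open>m 1\<close>.\<close>
  have step: "?T (Suc n) (Suc k) = m 0 (X (Suc (Suc n))) (?T n k)" if "k < n" for k
    using that by simp
  have "m 0 (\<Sum>k<n. s ((- 1) ^ k) (?T n k)) (X (Suc (Suc n))) =
      - m 0 (X (Suc (Suc n))) (\<Sum>k<n. s ((- 1) ^ k) (?T n k))"
    by (rule skew)
  also have "\<dots> = (\<Sum>k<n. s ((- 1) ^ Suc k) (?T (Suc n) (Suc k)))"
    unfolding m.right.sum sum_negf[symmetric]
    by (intro sum.cong refl) (simp only: lessThan_iff step m_scale_right power_Suc mult_minus1 scale_minus_left)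
  finally have "fps_nth (left_bracket mt (\<lambda>i. fps_const (X i)) (Suc (Suc n))) (Suc 0) =
      ?T (Suc n) 0 + (\<Sum>k<n. s ((- 1) ^ Suc k) (?T (Suc n) (Suc k)))"
    by (simp add: left_bracket_Suc left_bracket_mt_nth_0 Suc m.right.zero)
  then show ?case
    unfolding sum.lessThan_Suc_shift by simp
qed simp

text \<open>This turns the additivity rule of \<open>\<omega>\<^sub>t\<close> at order t into the
  one defining \<open>C2\<close>. Flipping the \<open>p - 1\<close> brackets of a word gives no
  sign, as \<open>p\<close> is odd.\<close>

lemma sum_jacobson_term_nth_1:
  assumes "odd p" and "p > 2"
  shows "fps_nth (\<Sum>k=1..p - 1. jacobson_term p (fps_scale s) mt k (fps_const x) (fps_const y)) 1 =
    C2_correction p s (m 0) (m 1) x y"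
proof -
  obtain n where p: "p = Suc n" and "even n" and "n \<ge> 2"
    using assms by (cases p) auto
  have const: "xy_word (fps_const x) (fps_const y) I = (\<lambda>i. fps_const (xy_word x y I i))" for I
    by (auto simp: xy_word_def)
  have range: "{0..n - 1} = {..<n}"
    using \<open>n \<ge> 2\<close> by auto
  have word: "fps_nth (left_bracket (\<lambda>u v. mt v u) (xy_word (fps_const x) (fps_const y) I) p) 1 =
      (\<Sum>k=0..p - 2. s ((- 1) ^ k)
         (foldr (\<lambda>i. m 0 (xy_word x y I i)) (rev [p - k + 1..<p + 1])
            (m 1 (left_bracket (m 0) (xy_word x y I) (p - k - 1)) (xy_word x y I (p - k)))))" for I
    unfolding p const using \<open>even n\<close> range
    by (simp add: left_bracket_flip[OF biadditive_mt mt_skew] left_bracket_mt_nth_1 del: upt_Suc)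
  have "fps_nth (\<Sum>k=1..p - 1. jacobson_term p (fps_scale s) mt k (fps_const x) (fps_const y)) 1 =
      (\<Sum>I\<in>{I \<in> words p. 2 \<notin> I}. s (inverse (of_nat (card I)))
        (fps_nth (left_bracket (\<lambda>u v. mt v u) (xy_word (fps_const x) (fps_const y) I) p) 1))"
    using assms by (subst mt.sum_jacobson_term) (simp_all add: additive_fps_scale fps_sum_nth)
  also have "\<dots> = C2_correction p s (m 0) (m 1) x y"
    unfolding word
    unfolding C2_correction_def Let_def xy_word_def[abs_def] words_def
    by (rule sum.cong) (blast, rule refl)
  finally show ?thesis .
qed

text \<open>Reads repeated right bracketing as the word x y ... y, so that the first-order formula
  for words applies.\<close>

lemma funpow_eq_left_bracket:
  "((\<lambda>u. M u y) ^^ n) x = left_bracket M (\<lambda>i. if i = 1 then x else y) (Suc n)"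
  by (induction n) (simp_all add: left_bracket_Suc)

text \<open>For \<open>n = p\<close> this is the sum in \<open>ind2\<close>.\<close>

lemma right_power_nth_1:
  "fps_nth (((\<lambda>u. mt u (fps_const y)) ^^ n) (fps_const x)) 1 =
     (\<Sum>k<n. s ((- 1) ^ k) ((m 0 y ^^ k) (m 1 (((\<lambda>u. m 0 u y) ^^ (n - 1 - k)) x) y)))"
proof -
  define X where "X i = (if i = 1 then x else y)" for i :: nat
  have const: "(\<lambda>i. if i = Suc 0 then fps_const x else fps_const y) = (\<lambda>i. fps_const (X i))"
    unfolding One_nat_def by (auto simp: X_def)
  \<comment> \<open>Only position 1 carries x, and the outer actions come from later
    positions.\<close>
  have fold: "foldr (\<lambda>i. m 0 (X i)) l u = (m 0 y ^^ length l) u" if "\<forall>i\<in>set l. i > 1" for l u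
    using that by (induction l) (auto simp: X_def)
  show ?thesis
    unfolding funpow_eq_left_bracket One_nat_def const left_bracket_mt_nth_1
  proof (intro sum.cong refl)
    fix k assume k: "k \<in> {..<n}"
    then have "Suc (n - Suc 0 - k) = n - k" and "X (Suc n - k) = y"
      by (auto simp: X_def)
    moreover have "foldr (\<lambda>i. m 0 (X i)) (rev [Suc n - k + 1..<Suc n + 1]) u = (m 0 y ^^ k) u" for u
      using k by (subst fold) (auto simp del: upt_Suc)
    ultimately show "s ((- 1) ^ k) (foldr (\<lambda>i. m 0 (X i)) (rev [Suc n - k + Suc 0..<Suc n + Suc 0])
          (m (Suc 0) (left_bracket (m 0) X (n - k)) (X (Suc n - k)))) =
        s ((- 1) ^ k) ((m 0 y ^^ k) (m (Suc 0)
          (left_bracket (m 0) (\<lambda>i. if i = Suc 0 then x else y) (Suc (n - Suc 0 - k))) y))"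
      by (simp add: X_def[abs_def] del: upt_Suc)
  qed
qed

text \<open>If \<open>y\<close> is divisible by \<open>t\<close> then only words with a single letter \<open>y\<close> count modulo \<open>t\<^sup>2\<close>.\<close>
lemma coeff_ad_power_nth:
  fixes x :: 'l and y :: "'l fps"
  assumes "fps_nth y 0 = 0"
  defines "c \<equiv> \<lambda>n. coeff ((poly_ext mt [:y, fps_const x:] ^^ Suc n) [:fps_const x:])"
  shows "fps_nth (c n k) 0 = 0 \<and>
    fps_nth (c n k) 1 = (if k = n then (m 0 x ^^ n) (m 0 (fps_nth y 1) x) else 0)"
proof (induction n arbitrary: k)
  case 0
  \<comment> \<open>The coefficient of Z is the bracket of x with itself, which vanishes.\<close>
  have "c 0 k = (if k = 0 then mt y (fps_const x) else 0)"
    by (auto simp: c_def mt.coeff_poly_ext_linear mt.right.zero coeff_pCons split: nat.splits)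
  then show ?case
    using assms by (auto simp: m.left.zero m.right.zero)
next
  case (Suc n)
  \<comment> \<open>Both \<open>y\<close> and \<open>c n k\<close> are divisible by t, so the first
    summand starts at order 2.\<close>
  have "c (Suc n) k = mt y (c n k) + (if k = 0 then 0 else mt (fps_const x) (c n (k - 1)))"
    by (simp add: c_def mt.coeff_poly_ext_linear)
  then show ?case
    using assms Suc by (auto simp: m.left.zero m.right.zero)
qed

text \<open>Only \<open>k = p - 1\<close> survives, the part with a single letter \<open>y\<close>.
  Its weight 1/(p - 1) is -1 in characteristic p, and turning the innermost bracket [y, x] into
  [x, y] gives a second sign.\<close>

lemma sum_jacobson_term_small_nth_1:
  assumes "CHAR('k) = p" and "p > 2" and "fps_nth y 0 = 0"
  shows "fps_nth (\<Sum>k=1..p - 1. jacobson_term p (fps_scale s) mt k (fps_const x) y) 1 =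
    (m 0 x ^^ (p - 1)) (fps_nth y 1)"
proof -
  obtain n where p: "p = Suc (Suc n)"
    using assms(2) by (metis Suc_1 less_imp_Suc_add add_Suc)
  have "additive (m 0 x ^^ n)"
    by (induction n) (auto simp: additive_def m.add_right)
  then have ad_minus: "(m 0 x ^^ n) (- v) = - (m 0 x ^^ n) v" for v
    by (rule additive.minus)
  have "of_nat p = (0::'k)"
    using assms(1) of_nat_CHAR by metis
  then have "1 + of_nat (Suc n) = (0::'k)"
    unfolding p by simp
  then have inverse: "inverse (of_nat (Suc n)) = (- 1 :: 'k)"
    by (metis add_eq_0_iff inverse_minus_eq inverse_1)
  have "fps_nth (\<Sum>k=1..p - 1. jacobson_term p (fps_scale s) mt k (fps_const x) y) 1 =
      (\<Sum>k=1..Suc n. if k = Suc n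
        then s (inverse (of_nat (Suc n))) ((m 0 x ^^ n) (m 0 (fps_nth y 1) x)) else 0)"
    unfolding fps_sum_nth p jacobson_term_def fps_scale_nth diff_Suc_1 coeff_ad_power_nth[OF assms(3), THEN conjunct2]
    by (intro sum.cong) auto
  also have "\<dots> = s (inverse (of_nat (Suc n))) ((m 0 x ^^ n) (m 0 (fps_nth y 1) x))"
    by simp
  also have "\<dots> = (m 0 x ^^ n) (m 0 x (fps_nth y 1))"
    unfolding inverse skew[of 0 "fps_nth y 1" x] ad_minus by simp
  finally show ?thesis
    by (simp add: p funpow_swap1)
qed

end

section \<open>Infinitesimals\<close>

lemma formal_deformation_skew_family:
  assumes "vector_space sL" and "(2::'k::field) \<noteq> 0"
    and "formal_deformation p sA (sL :: 'k \<Rightarrow> _) act br pm \<rho> m \<omega>"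
  shows "skew_family sL m"
proof -
  obtain \<sigma> where "restricted_multiderivation p sA sL act (m i) (\<omega> i) (\<sigma> i)" for i
    using assms(3) unfolding formal_deformation_def by blast
  then show ?thesis
    using assms(1,2) unfolding skew_family_def skew_family_axioms_def restricted_multiderivation_def
    by blast
qed

text \<open>At order t, the additivity rule of \<open>\<omega>\<^sub>t\<close> gives the cochain
  condition, the Jacobi identity gives \<open>d2_CE\<close>, and the rule for brackets with
  \<open>\<omega>\<^sub>t\<close> gives \<open>ind2\<close>. The cochain condition mixes
  \<open>br\<close> with \<open>m 1\<close>, so it is read off from the whole series.\<close>

lemma infinitesimal_in_Z2:
  fixes sL :: "'k::field \<Rightarrow> 'l::ab_group_add \<Rightarrow> 'l"
  assumes "vector_space sL" and "(2::'k) \<noteq> 0" and "odd p" and "p > 2"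
    and def: "formal_deformation p sA sL act br pm \<rho> m \<omega>"
  shows "(m 1, \<omega> 1) \<in> Z2 p sL br pm"
proof -
  interpret skew_family sL m
    using assms by (intro formal_deformation_skew_family)
  have br: "m 0 = br" and pm: "\<omega> 0 = pm"
    using def unfolding formal_deformation_def by blast+
  obtain \<sigma> where multi: "\<forall>i. restricted_multiderivation p sA sL act (m i) (\<omega> i) (\<sigma> i)"
    and jacobi: "\<forall>x y z. mt (fps_const x) (mt (fps_const y) (fps_const z)) +
      mt (fps_const y) (mt (fps_const z) (fps_const x)) +
      mt (fps_const z) (mt (fps_const x) (fps_const y)) = 0"
    and restricted: "\<forall>x y. mt (fps_const x) (series \<omega> y) =
      ((\<lambda>u. mt u (fps_const y)) ^^ p) (fps_const x)"
    and sum: "\<forall>x y. series \<omega> (x + y) = series \<omega> x + series \<omega> y +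
      (\<Sum>k=1..p - 1. jacobson_term p (fps_scale sL) mt k (fps_const x) (fps_const y))"
    using def unfolding formal_deformation_def by (elim conjE exE) (rule that; assumption)
  have homogeneous: "\<omega> 1 (sL c x) = sL (c ^ p) (\<omega> 1 x)" for c x
    using spec[OF multi, of 1] unfolding restricted_multiderivation_def by blast
  have C2: "(m 1, \<omega> 1) \<in> C2 p sL br"
  proof -
    have "\<omega> 1 (x + y) = \<omega> 1 x + \<omega> 1 y + C2_correction p sL br (m 1) x y" for x y
      using arg_cong[OF sum[rule_format], of "\<lambda>f. fps_nth f 1" x y] assms(3,4)
      unfolding fps_add_nth sum_jacobson_term_nth_1[OF assms(3,4)] br by (simp add: series_def)
    then show ?thesis
      unfolding C2_def by (intro CollectI case_prodI conjI allI bilinear skew homogeneous)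
  qed
  moreover have "d2_CE br (m 1) x y z = 0" for x y z
  proof -
    \<comment> \<open>Skewness brings all six terms into the cyclic order of the Jacobi identity, up
      to a global sign.\<close>
    have 1: "m 1 (br x y) z = - m 1 z (br x y)" and 2: "m 1 (br y z) x = - m 1 x (br y z)"
      by (rule skew)+
    have 3: "m 1 (br x z) y = m 1 y (br z x)"
      unfolding skew[of 0 x z, unfolded br] skew[of 1 "- br z x" y] m.right.minus minus_minus ..
    have 4: "br y (m 1 x z) = - br y (m 1 z x)"
      unfolding br[symmetric] skew[of 1 x z] m.right.minus ..
    have "d2_CE br (m 1) x y z = - (br x (m 1 y z) + m 1 x (br y z) +
        (br y (m 1 z x) + m 1 y (br z x)) + (br z (m 1 x y) + m 1 z (br x y)))"
      unfolding d2_CE_def 1 2 3 4 by (simp add: algebra_simps)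
    also have "br x (m 1 y z) + m 1 x (br y z) + (br y (m 1 z x) + m 1 y (br z x))
        + (br z (m 1 x y) + m 1 z (br x y)) = 0"
      using arg_cong[OF jacobi[rule_format], of "\<lambda>f. fps_nth f 1" x y z]
      by (simp add: br m.left.zero[of 0, unfolded br] m.right.zero[of 0, unfolded br])
    finally show ?thesis
      by simp
  qed
  moreover have "ind2 p sL br pm (m 1) (\<omega> 1) x y = 0" for x y
  proof -
    have "{..<p} = {0..p - 1}"
      using assms(4) by auto
    then show ?thesis
      using arg_cong[OF restricted[rule_format], of "\<lambda>f. fps_nth f 1" x y]
      unfolding right_power_nth_1 ind2_def br
      by (simp add: series_def pm br m.left.zero[of 0, unfolded br] algebra_simps)
  qed
  ultimately show ?thesis
    by (simp add: Z2_def)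
qed

lemma equivalent_infinitesimals_differ_by_coboundary:
  fixes sL :: "'k::field \<Rightarrow> 'l::ab_group_add \<Rightarrow> 'l"
  assumes "CHAR('k) = p" and "p > 2" and "skew_family sL m"
    and "m 0 = br" "m' 0 = br" "\<omega> 0 = pm" "\<omega>' 0 = pm"
    and "equivalent_deformations p sL m \<omega> m' \<omega>'"
  shows "cochain_diff (m 1, \<omega> 1) (m' 1, \<omega>' 1) \<in> B2 p sL br pm"
proof -
  interpret skew_family sL m
    by fact
  obtain \<phi> W where id: "\<phi> 0 = id" and linear: "Vector_Spaces.linear sL sL (\<phi> 1)"
    and W: "is_omega_ext p sL m \<omega> W"
    and hom: "\<And>x y. mt (series \<phi> x) (series \<phi> y) =
          lin_ext \<phi> (bilin_ext m' (fps_const x) (fps_const y))"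
    and W_hom: "\<And>x. W (series \<phi> x) = lin_ext \<phi> (series \<omega>' x)"
    using assms(8) unfolding equivalent_deformations_def by blast
  interpret \<phi>: additive "\<phi> 1"
    using linear by (auto simp: additive_def Vector_Spaces.linear_iff)
  have "m 1 x y - m' 1 x y = \<phi> 1 (br x y) - br x (\<phi> 1 y) + br y (\<phi> 1 x)" for x y
  proof -
    have "fps_nth (bilin_ext m' (fps_const x) (fps_const y)) 1 =
        m' 0 x 0 + m' 0 0 y + m' 1 x y"
      by (simp add: bilin_ext_def)
    \<comment> \<open>The locale speaks of \<open>m\<close>; its zero laws carry over because
      \<open>m' 0\<close> and \<open>m 0\<close> are both \<open>br\<close>.\<close>
    also have "\<dots> = m' 1 x y"
      using m.left.zero[of 0] m.right.zero[of 0] by (simp add: assms(4,5))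
    finally have "br x (\<phi> 1 y) + br (\<phi> 1 x) y + m 1 x y = m' 1 x y + \<phi> 1 (br x y)"
      using arg_cong[OF hom, of "\<lambda>f. fps_nth f 1" x y]
      by (simp add: lin_ext_def series_def id assms(4,5)) (simp add: bilin_ext_def assms(5))
    moreover have "br (\<phi> 1 x) y = - br y (\<phi> 1 x)"
      unfolding assms(4)[symmetric] by (rule skew)
    ultimately show ?thesis
      by (simp add: algebra_simps)
  qed
  moreover have "\<omega> 1 x - \<omega>' 1 x = \<phi> 1 (pm x) - (br x ^^ (p - 1)) (\<phi> 1 x)" for x
  proof -
    \<comment> \<open>\<open>v\<close> is (\<phi>(x) - x)/t, and \<open>y = t v\<close> has the form
      to which the homogeneity of \<open>W\<close> applies.\<close>
    define v where "v = Abs_fps (\<lambda>n. \<phi> (Suc n) x)"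
    define y where "y = fps_smult sL fps_X v"
    have y: "fps_nth y n = (if n = 0 then 0 else \<phi> n x)" for n
    proof -
      have "fps_nth y n = (\<Sum>i\<le>n. if i = 1 then \<phi> (Suc (n - 1)) x else 0)"
        unfolding y_def v_def fps_smult_def fps_nth_Abs_fps by (rule sum.cong) auto
      then show ?thesis
        by simp
    qed
    have "fps_nth (W y) 1 = 0"
    proof -
      have "W y = fps_smult sL (fps_X ^ p) (W v)"
        using W unfolding y_def is_omega_ext_def by blast
      then show ?thesis
        using assms(2) by (simp add: fps_smult_def fps_X_power_nth)
    qed
    moreover have "series \<phi> x = fps_const x + y"
      by (rule fps_ext) (simp add: series_def y id)
    then have "W (series \<phi> x) = series \<omega> x + W y +
        (\<Sum>k=1..p - 1. jacobson_term p (fps_scale sL) mt k (fps_const x) y)"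
      using W unfolding is_omega_ext_def by metis
    ultimately have "fps_nth (W (series \<phi> x)) 1 = \<omega> 1 x + (br x ^^ (p - 1)) (\<phi> 1 x)"
      using sum_jacobson_term_small_nth_1[OF assms(1,2), of y x]
      by (simp add: y assms(4)) (simp add: series_def)
    \<comment> \<open>The same coefficient is computed from the other side of the equivalence
      condition.\<close>
    moreover have "fps_nth (W (series \<phi> x)) 1 = \<omega>' 1 x + \<phi> 1 (pm x)"
      unfolding W_hom by (simp add: lin_ext_def series_def id assms(7))
    ultimately show ?thesis
      by (simp add: algebra_simps)
  qed
  ultimately have "cochain_diff (m 1, \<omega> 1) (m' 1, \<omega>' 1) = d1 p br pm (\<phi> 1)"
    by (simp add: cochain_diff_def d1_def)
  then show ?thesis
    using linear by (auto simp: B2_def C1_def)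
qed

theorem theorem3p7:
  fixes sA :: "'k::field \<Rightarrow> 'a::comm_ring \<Rightarrow> 'a"
    and sL :: "'k \<Rightarrow> 'l::ab_group_add \<Rightarrow> 'l"
    and act :: "'a \<Rightarrow> 'l \<Rightarrow> 'l"
    and br :: "'l \<Rightarrow> 'l \<Rightarrow> 'l"
    and pm :: "'l \<Rightarrow> 'l"
    and \<rho> :: "'l \<Rightarrow> 'a \<Rightarrow> 'a"
    and m m' :: "nat \<Rightarrow> 'l \<Rightarrow> 'l \<Rightarrow> 'l"
    and \<omega> \<omega>' :: "nat \<Rightarrow> 'l \<Rightarrow> 'l"
    and p :: nat
  assumes "CHAR('k) = p" and "p > 2"
    and "restricted_lie_rinehart p sA sL act br pm \<rho>"
    and "formal_deformation p sA sL act br pm \<rho> m \<omega>"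
    and "formal_deformation p sA sL act br pm \<rho> m' \<omega>'"
    and "equivalent_deformations p sL m \<omega> m' \<omega>'"
  shows "(\<exists>h\<in>H2 p sL br pm. (m 1, \<omega> 1) \<in> h \<and> (m' 1, \<omega>' 1) \<in> h) \<and>
         cochain_diff (m 1, \<omega> 1) (m' 1, \<omega>' 1) \<in> B2 p sL br pm"
proof -
  have "prime p"
    using prime_CHAR_semidom[where 'a = 'k] assms(1,2) by simp
  then have "odd p"
    using assms(2) prime_odd_nat by simp
  have "\<not> p dvd 2"
    using assms(2) by (auto dest: dvd_imp_le)
  then have two: "(2::'k) \<noteq> 0"
    using of_nat_eq_0_iff_char_dvd[where 'a = 'k, of 2] assms(1) by simp
  have vs: "vector_space sL"
    using assms(3) by (simp add: restricted_lie_rinehart_def finite_dim_def)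
  note skew = formal_deformation_skew_family[OF vs two]
  have Z2: "(m 1, \<omega> 1) \<in> Z2 p sL br pm" "(m' 1, \<omega>' 1) \<in> Z2 p sL br pm"
    using infinitesimal_in_Z2[OF vs two \<open>odd p\<close> assms(2)] assms(4,5) by auto
  have diff: "cochain_diff (m 1, \<omega> 1) (m' 1, \<omega>' 1) \<in> B2 p sL br pm"
    using assms(4,5) unfolding formal_deformation_def
    by (intro equivalent_infinitesimals_differ_by_coboundary assms(1,2,6) skew[OF assms(4)]) auto
  \<comment> \<open>The common class is the image of \<open>(m 1, \<omega> 1)\<close> under the
    relation in \<open>H2\<close>. That it contains this pair itself needs zero to be a coboundary,
    namely that of the zero map.\<close>
  interpret skew_family sL m
    by (rule skew[OF assms(4)])
  have "m 0 = br"
    using assms(4) by (simp add: formal_deformation_def)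
  have "additive (br x ^^ n)" for x n
    by (induction n) (auto simp: additive_def m.add_right[of 0, unfolded \<open>m 0 = br\<close>])
  then have "cochain_diff (m 1, \<omega> 1) (m 1, \<omega> 1) = d1 p br pm (\<lambda>_. 0)"
    using m.right.zero[of 0] \<open>m 0 = br\<close>
    by (simp add: cochain_diff_def d1_def additive.zero fun_eq_iff)
  moreover have "Vector_Spaces.linear sL sL (\<lambda>_. 0)"
    using vs by (simp add: Vector_Spaces.linear_iff)
  ultimately have "cochain_diff (m 1, \<omega> 1) (m 1, \<omega> 1) \<in> B2 p sL br pm"
    by (auto simp: B2_def C1_def)
  then show ?thesis
    using Z2 diff by (auto simp: H2_def quotient_def)
qed

end
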